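(* Let $\mathbb{D}=\{z\in\mathbb{C}:|z|<1\}$ and $r_{\mathrm c}=2\sqrt6-3-2\sqrt{8-3\sqrt6}=0.2846\cdots$. If $r\in[0,r_{\mathrm c})$, then $$g_{\mathbb{D}}(z,w;r)<1\quad\text{for all }(z,w)\in\mathbb{D}^2,$$ where $g_{\mathbb{D}}$ is the unfolded 2-correlation function defined in the context.
   Context: For $s\ge0$ let $S_{\mathbb{D}}(z,w;s)=\frac{1+sz\overline{w}}{(1+s)(1-z\overline{w})}$, $z,w\in\mathbb{D}$. For $r\ge0$ put $$\rho^1_{\mathbb{D}}(z;r)=\frac{(1+r)(1+r|z|^4)}{(1+r|z|^2)^2(1-|z|^2)^2},\qquad\rho^2_{\mathbb{D}}(z_1,z_2;r)=\frac{1+r}{1+r|z_1|^4|z_2|^4}\ \mathrm{perdet}_{1\le i,j\le2}\big[S_{\mathbb{D}}(z_i,z_j;r|z_1|^2|z_2|^2)\big],$$ where $\mathrm{perdet}\,M=\mathrm{per}\,M\cdot\det M$. These are the one- and two-point correlation functions (with respect to Lebesgue measure divided by $\pi$) of the zeros of the Gaussian power series $\frac{\zeta_0}{\sqrt{1+r}}+\sum_{n\ge1}\zeta_nz^n$ on $\mathbb{D}$, with $\zeta_n$ i.i.d. standard complex Gaussian. The unfolded 2-correlation function is $g_{\mathbb{D}}(z,w;r)=\rho^2_{\mathbb{D}}(z,w;r)/(\rho^1_{\mathbb{D}}(z;r)\rho^1_{\mathbb{D}}(w;r))$. *)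

theory Defs
  imports "HOL-Analysis.Analysis"
begin

definition unit_disk :: "complex set" where
  "unit_disk = ball 0 1"

definition per :: "'a::comm_ring_1^'n^'n \<Rightarrow> 'a" where
  "per A = (\<Sum>p | p permutes (UNIV :: 'n set). \<Prod>i\<in>UNIV. A $ i $ p i)"

definition perdet :: "'a::comm_ring_1^'n^'n \<Rightarrow> 'a" where
  "perdet A = per A * det A"

definition S_disk :: "complex \<Rightarrow> complex \<Rightarrow> real \<Rightarrow> complex" where
  "S_disk z w s =
     (1 + of_real s * z * cnj w) / ((1 + of_real s) * (1 - z * cnj w))"

definition rho1_disk :: "complex \<Rightarrow> real \<Rightarrow> real" where
  "rho1_disk z r =
     (1 + r) * (1 + r * cmod z ^ 4) / ((1 + r * (cmod z)\<^sup>2)\<^sup>2 * (1 - (cmod z)\<^sup>2)\<^sup>2)"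

definition S_disk_matrix :: "complex^'n \<Rightarrow> real \<Rightarrow> complex^'n^'n" where
  "S_disk_matrix z s = (\<chi> i j. S_disk (z $ i) (z $ j) s)"

text \<open>
  The matrix is Hermitian, so its perdet is a real number; \<open>Re\<close> only changes the type
  from complex to real and discards nothing (see \<open>of_real_rho2_disk\<close>).
\<close>
definition rho2_disk :: "complex \<Rightarrow> complex \<Rightarrow> real \<Rightarrow> real" where
  "rho2_disk z1 z2 r =
     (1 + r) / (1 + r * cmod z1 ^ 4 * cmod z2 ^ 4) *
     Re (perdet (S_disk_matrix (vector [z1, z2] :: complex^2) (r * (cmod z1)\<^sup>2 * (cmod z2)\<^sup>2)))"

definition g_disk :: "complex \<Rightarrow> complex \<Rightarrow> real \<Rightarrow> real" where
  "g_disk z w r = rho2_disk z w r / (rho1_disk z r * rho1_disk w r)"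

definition r_crit :: real where
  "r_crit = 2 * sqrt 6 - 3 - 2 * sqrt (8 - 3 * sqrt 6)"

lemma cnj_S_disk: "cnj (S_disk z w s) = S_disk w z s"
  by (simp add: S_disk_def mult_ac)

lemma per_2: "per (A :: 'a::comm_ring_1^2^2) = A$1$1 * A$2$2 + A$1$2 * A$2$1"
proof -
  have f12: "finite {2::2}" "1 \<notin> {2::2}" by auto
  show ?thesis
    unfolding per_def UNIV_2
    unfolding sum_over_permutations_insert[OF f12]
    unfolding permutes_sing
    by simp
qed

lemma of_real_rho2_disk:
  "complex_of_real (rho2_disk z1 z2 r) =
     of_real ((1 + r) / (1 + r * cmod z1 ^ 4 * cmod z2 ^ 4)) *
     perdet (S_disk_matrix (vector [z1, z2] :: complex^2) (r * (cmod z1)\<^sup>2 * (cmod z2)\<^sup>2))"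
proof -
  have "perdet (S_disk_matrix (vector [z1, z2] :: complex^2) s) \<in> \<real>" for s
    unfolding perdet_def per_2 det_2 S_disk_matrix_def
    by (simp add: Reals_cnj_iff cnj_S_disk mult_ac)
  then show ?thesis
    by (simp only: rho2_disk_def of_real_mult of_real_Re)
qed

end

theory Submission
  imports Defs
begin

text \<open>
  Put \<open>a = |z|\<^sup>2\<close>, \<open>b = |w|\<^sup>2\<close>, \<open>c = |zw|\<close>. For given moduli, \<open>|S(z, w)|\<close> is smallest when \<open>z\<close> and \<open>w\<close>
  have opposite arguments. Clearing denominators, \<open>g < 1\<close> becomes a polynomial inequality whose
  difference of sides is exactly divisible by \<open>e\<^sup>2\<close> with \<open>e = (1 - a) * (1 - b)\<close>, because \<open>g\<close> tends
  to 1 to second order at the boundary. The cofactor is bounded below using \<open>2 * c \<le> a + b\<close>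
  and \<open>e \<ge> 0\<close>, which leaves an expression in \<open>c\<close> alone whose critical case is \<open>c = 1\<close>; there its
  sign is that of \<open>(r\<^sup>2 + 6 * r + 1)\<^sup>2 - 96 * r\<^sup>2\<close>, of which \<open>r_crit\<close> is a root.
\<close>

section \<open>The critical parameter and positivity on the diagonal\<close>

lemma r_crit_less: "r_crit < 1"
proof -
  \<comment> \<open>The rational bound keeps \<open>8 - 3 * sqrt 6\<close> at least
    \<open>13/20\<close>, just above \<open>(4/5)^2\<close>; together they give
    \<open>r_crit <= 3/10\<close>.\<close>
  have "sqrt 6 \<le> 49/20" by (rule real_le_lsqrt) (auto simp: power2_eq_square)
  moreover from this have "sqrt (8 - 3 * sqrt 6) \<ge> 4/5"
    by (intro real_le_rsqrt) (auto simp: power2_eq_square)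
  ultimately show ?thesis unfolding r_crit_def by linarith
qed

text \<open>\<open>r_crit\<close> is the smaller root of
  \<open>r^2 + 6 * r + 1 - 4 * sqrt 6 * r\<close>, which is therefore positive to its left. Undoing
  the outer square root of \<open>r_crit\<close> yields this quadratic; one more squaring removes
  \<open>sqrt 6\<close>.\<close>

lemma r_crit_quartic:
  assumes "0 \<le> r" "r < r_crit"
  shows "96 * r\<^sup>2 < (r\<^sup>2 + 6 * r + 1)\<^sup>2"
proof -
  have "3 * sqrt 6 \<le> 8"
    by (rule power2_le_imp_le) (auto simp: power_mult_distrib)
  then have sq: "(sqrt (8 - 3 * sqrt 6))\<^sup>2 = 8 - 3 * sqrt 6" by simp
  have "2 * sqrt (8 - 3 * sqrt 6) < 2 * sqrt 6 - 3 - r"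
    using assms(2) by (simp add: r_crit_def)
  then have "(2 * sqrt (8 - 3 * sqrt 6))\<^sup>2 < (2 * sqrt 6 - 3 - r)\<^sup>2"
    using \<open>3 * sqrt 6 \<le> 8\<close> by (intro power_strict_mono) auto
  then have "4 * sqrt 6 * r < r\<^sup>2 + 6 * r + 1"
    unfolding power_mult_distrib sq by (simp add: power2_eq_square algebra_simps)
  then have "(4 * sqrt 6 * r)\<^sup>2 < (r\<^sup>2 + 6 * r + 1)\<^sup>2"
    using assms(1) by (intro power_strict_mono) auto
  then show ?thesis by (simp add: power_mult_distrib)
qed

text \<open>
  The bracket multiplying \<open>r * (1 + r * c\<^sup>2)\<^sup>2\<close> decreases in \<open>c\<close>, and so does the last summand.
  Hence the sum is positive where the bracket is nonnegative, and otherwise it is at least its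
  value \<open>(1 + r)^4 * ((r\<^sup>2 + 6 * r + 1)\<^sup>2 - 96 * r\<^sup>2) / 16\<close> at \<open>c = 1\<close>.
\<close>
lemma diagonal_pos:
  fixes r c :: real
  assumes r: "0 \<le> r" "r < 1" and K: "96 * r\<^sup>2 < (r\<^sup>2 + 6 * r + 1)\<^sup>2"
    and c: "0 \<le> c" "c \<le> 1"
  shows "0 < r * (1 + r * c\<^sup>2)\<^sup>2 * ((1 - r\<^sup>2 * c^4)\<^sup>2 - 2 * r * c\<^sup>2 * (1 + r) * (1 + r * c^4))
           + ((1 + r * c) * (1 - r * c^3) / (1 + c))^4"
    (is "0 < r * ?q\<^sup>2 * ?M + ?h^4")
proof -
  have c_pow: "c^n \<le> 1" for n using c by (simp add: power_le_one)
  have rc3: "r * c^3 \<le> r" "r\<^sup>2 * c^4 \<le> r\<^sup>2"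
    using r c_pow by (auto intro: mult_left_le)
  have r2: "r\<^sup>2 < 1" using r by (simp add: power_less_one_iff)
  have h1: "(1 + r) / 2 \<le> (1 + r * c) / (1 + c)"
  proof -
    have "(1 + r * c) * 2 - (1 + r) * (1 + c) = (1 - r) * (1 - c)" by algebra
    also have "\<dots> \<ge> 0" using r c by simp
    finally show ?thesis using c by (simp add: divide_simps)
  qed
  have "(1 + r) / 2 * (1 - r) \<le> (1 + r * c) / (1 + c) * (1 - r * c^3)"
    using h1 rc3 r c by (intro mult_mono) auto
  then have h: "(1 + r) * (1 - r) / 2 \<le> ?h" by simp
  then have h4: "((1 + r) * (1 - r) / 2)^4 \<le> ?h^4"
    using r by (intro power_mono) auto
  have hpos: "0 < ((1 + r) * (1 - r) / 2)^4" using r by simp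
  show ?thesis
  proof (cases "0 \<le> ?M")
    case True
    then have "0 \<le> r * ?q\<^sup>2 * ?M" using r by simp
    with h4 hpos show ?thesis by linarith
  next
    case False
    define N where "N = (1 - r\<^sup>2)\<^sup>2 - 2 * r * (1 + r) * (1 + r)"
    have "2 * r * c\<^sup>2 * (1 + r) * (1 + r * c^4) \<le> 2 * r * 1 * (1 + r) * (1 + r * 1)"
      using r c_pow by (intro mult_mono add_mono) auto
    moreover have "(1 - r\<^sup>2)\<^sup>2 \<le> (1 - r\<^sup>2 * c^4)\<^sup>2"
      using rc3 r2 by (intro power_mono) auto
    ultimately have NM: "N \<le> ?M"
      unfolding N_def by (simp only: mult.right_neutral diff_mono)
    have "?q\<^sup>2 \<le> (1 + r)\<^sup>2"
      using r c_pow by (intro power_mono add_mono mult_left_le) auto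
    \<comment> \<open>Here \<open>N <= ?M < 0\<close>, so the signs are flipped to multiply
      inequalities between nonnegative quantities.\<close>
    then have "?q\<^sup>2 * (- ?M) \<le> (1 + r)\<^sup>2 * (- N)"
      using False NM by (intro mult_mono) auto
    then have "(1 + r)\<^sup>2 * N \<le> ?q\<^sup>2 * ?M"
      by (simp only: mult_minus_right neg_le_iff_le)
    then have "r * ((1 + r)\<^sup>2 * N) \<le> r * (?q\<^sup>2 * ?M)"
      using r(1) by (rule mult_left_mono)
    \<comment> \<open>Since \<open>N = (1 + r)^2 * (r^2 - 4 * r + 1)\<close>, both summands contain
      \<open>(1 + r)^4\<close>.\<close>
    moreover have "r * ((1 + r)\<^sup>2 * N) + ((1 + r) * (1 - r) / 2)^4
        = (1 + r)^4 / 16 * ((r\<^sup>2 + 6 * r + 1)\<^sup>2 - 96 * r\<^sup>2)"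
      unfolding N_def by (simp add: field_simps power_divide) algebra
    moreover have "0 < (1 + r)^4 / 16 * ((r\<^sup>2 + 6 * r + 1)\<^sup>2 - 96 * r\<^sup>2)"
      using r K by simp
    ultimately show ?thesis using h4 by (simp only: mult.assoc)
  qed
qed

section \<open>The polynomial inequality behind \<open>g < 1\<close>\<close>

text \<open>Everything symmetric in \<open>a\<close> and \<open>b\<close> is a polynomial in
  \<open>d\<close> and \<open>e\<close>, because \<open>a + b = 1 + d - e\<close>. In these
  variables both products on the left have the leading term \<open>W^2 * q^4\<close> and the same
  linear term in \<open>e\<close>, so their difference starts at \<open>e^2\<close>.\<close>

lemma correlation_identity:
  fixes a b r x :: real
  defines "e \<equiv> (1 - a) * (1 - b)" and "d \<equiv> a * b"
  shows "(1 + r) * ((1 + r * a\<^sup>2) * (1 + r * b\<^sup>2)) * (1 + r * d\<^sup>2) * (1 + r * d)^4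
      - ((1 + r * a) * (1 + r * b))\<^sup>2 * ((1 + r * d * a)\<^sup>2 * (1 + r * d * b)\<^sup>2 - e\<^sup>2 * x)
    = e\<^sup>2 * (r * (1 + r * d)\<^sup>2 * ((1 - r\<^sup>2 * d\<^sup>2)\<^sup>2 - 2 * r * d * (1 + r) * (1 + r * d\<^sup>2))
        + r^3 * d * e * (2 * (1 + r * d)\<^sup>2 * (1 + d) - r * d * e)
        + ((1 + r * a) * (1 + r * b))\<^sup>2 * x)"
proof -
  define q where "q = 1 + r * d"
  define W where "W = (1 + r) * (1 + r * d\<^sup>2)"
  define T where "T = 1 + d"
  have sumsq: "(1 + r) * (1 + r * d\<^sup>2) * ((1 + r * a\<^sup>2) * (1 + r * b\<^sup>2))
      = W * (W - 2 * r * T * e + r * e\<^sup>2)"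
    unfolding W_def T_def e_def d_def by algebra
  have AB: "(1 + r * a) * (1 + r * b) * ((1 + r * d * a) * (1 + r * d * b))
      = q\<^sup>2 * (W - r * T * e) + r\<^sup>2 * d * e\<^sup>2"
    unfolding q_def W_def T_def e_def d_def by algebra
  have WT: "W - r * T\<^sup>2 = (1 - r * d)\<^sup>2"
    unfolding W_def T_def by algebra
  have "(1 + r) * ((1 + r * a\<^sup>2) * (1 + r * b\<^sup>2)) * (1 + r * d\<^sup>2) * q^4
      - ((1 + r * a) * (1 + r * b))\<^sup>2 * ((1 + r * d * a)\<^sup>2 * (1 + r * d * b)\<^sup>2 - e\<^sup>2 * x)
    = (1 + r) * (1 + r * d\<^sup>2) * ((1 + r * a\<^sup>2) * (1 + r * b\<^sup>2)) * q^4
      - ((1 + r * a) * (1 + r * b) * ((1 + r * d * a) * (1 + r * d * b)))\<^sup>2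
      + ((1 + r * a) * (1 + r * b))\<^sup>2 * e\<^sup>2 * x"
    by algebra
  also have "\<dots> = e\<^sup>2 * (r * q^4 * (W - r * T\<^sup>2) - 2 * r\<^sup>2 * d * q\<^sup>2 * (W - r * T * e)
      - r^4 * d\<^sup>2 * e\<^sup>2 + ((1 + r * a) * (1 + r * b))\<^sup>2 * x)"
    unfolding sumsq AB by algebra
  also have "\<dots> = e\<^sup>2 * (r * q\<^sup>2 * ((q * (1 - r * d))\<^sup>2 - 2 * r * d * W)
      + r^3 * d * e * (2 * q\<^sup>2 * T - r * d * e) + ((1 + r * a) * (1 + r * b))\<^sup>2 * x)"
    unfolding WT by algebra
  also have "q * (1 - r * d) = 1 - r\<^sup>2 * d\<^sup>2"
    unfolding q_def by algebra
  finally show ?thesis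
    unfolding q_def W_def T_def by (simp only: mult.assoc)
qed

text \<open>Here \<open>x\<close> stands for \<open>((1 + s) * |S|)^4\<close> with
  \<open>s = r * a * b\<close>; its lower bound is the case of opposite arguments, where
  \<open>s * c = r * c^3\<close>.\<close>

lemma correlation_ineq:
  fixes a b c r x :: real
  assumes r: "0 \<le> r" "r < 1" and K: "96 * r\<^sup>2 < (r\<^sup>2 + 6 * r + 1)\<^sup>2"
    and a: "0 \<le> a" "a < 1" and b: "0 \<le> b" "b < 1"
    and c: "0 \<le> c" "c\<^sup>2 = a * b"
    and x: "((1 - r * c^3) / (1 + c))^4 \<le> x"
  shows "((1 + r * a) * (1 + r * b))\<^sup>2 *
      ((1 + r * (a * b) * a)\<^sup>2 * (1 + r * (a * b) * b)\<^sup>2 - ((1 - a) * (1 - b))\<^sup>2 * x)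
    < (1 + r) * ((1 + r * a\<^sup>2) * (1 + r * b\<^sup>2)) * (1 + r * (a * b)\<^sup>2) * (1 + r * (a * b))^4"
proof -
  define e d where "e = (1 - a) * (1 - b)" and "d = a * b"
  have d: "0 \<le> d" "d \<le> 1" using a b by (auto simp: d_def mult_le_one)
  have cd: "c\<^sup>2 = d" "c^4 = d\<^sup>2" using c by (auto simp: d_def power2_eq_square power4_eq_xxxx)
  have c1: "c \<le> 1" using c(1) cd(1) d by (metis power2_le_imp_le one_power2 zero_le_one)
  have e: "0 < e" "e \<le> 1" using a b by (auto simp: e_def mult_le_one)
  have "2 * c \<le> a + b"
  proof (rule power2_le_imp_le)
    have "(a + b)\<^sup>2 - (2 * c)\<^sup>2 = (a - b)\<^sup>2" using c(2) by algebra
    then show "(2 * c)\<^sup>2 \<le> (a + b)\<^sup>2" by (metis diff_ge_0_iff_ge zero_le_power2)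
  qed (use a b in auto)
  then have "r * (2 * c) \<le> r * (a + b)" using r by (intro mult_left_mono)
  moreover have "(1 + r * a) * (1 + r * b) - (1 + r * c)\<^sup>2 = r * (a + b) - r * (2 * c)"
    using c(2) by algebra
  ultimately have "(1 + r * c)\<^sup>2 \<le> (1 + r * a) * (1 + r * b)" by linarith
  then have "((1 + r * c)\<^sup>2)\<^sup>2 \<le> ((1 + r * a) * (1 + r * b))\<^sup>2"
    by (intro power_mono) auto
  then have "((1 + r * c)\<^sup>2)\<^sup>2 * ((1 - r * c^3) / (1 + c))^4 \<le> ((1 + r * a) * (1 + r * b))\<^sup>2 * x"
    using x by (intro mult_mono) auto
  then have "((1 + r * c) * (1 - r * c^3) / (1 + c))^4 \<le> ((1 + r * a) * (1 + r * b))\<^sup>2 * x"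
    by (simp add: power_mult_distrib power_divide)
  \<comment> \<open>The bracket is at least \<open>2 - 1\<close>, so this summand only
    helps.\<close>
  moreover have "0 \<le> r^3 * d * e * (2 * (1 + r * d)\<^sup>2 * (1 + d) - r * d * e)"
  proof -
    have "r * d * e \<le> 1" using r d e by (simp add: mult_le_one)
    moreover have "1 * 1 \<le> (1 + r * d)\<^sup>2 * (1 + d)"
      using r d by (intro mult_mono one_le_power) auto
    ultimately show ?thesis using r d e by (intro mult_nonneg_nonneg) auto
  qed
  ultimately have "0 < r * (1 + r * d)\<^sup>2 * ((1 - r\<^sup>2 * d\<^sup>2)\<^sup>2 - 2 * r * d * (1 + r) * (1 + r * d\<^sup>2))
        + r^3 * d * e * (2 * (1 + r * d)\<^sup>2 * (1 + d) - r * d * e)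
        + ((1 + r * a) * (1 + r * b))\<^sup>2 * x"
    using diagonal_pos[OF r K c(1) c1] unfolding cd by linarith
  then have "0 < e\<^sup>2 * (r * (1 + r * d)\<^sup>2 * ((1 - r\<^sup>2 * d\<^sup>2)\<^sup>2 - 2 * r * d * (1 + r) * (1 + r * d\<^sup>2))
        + r^3 * d * e * (2 * (1 + r * d)\<^sup>2 * (1 + d) - r * d * e)
        + ((1 + r * a) * (1 + r * b))\<^sup>2 * x)"
    using e by simp
  then show ?thesis
    using correlation_identity[of r a b x] unfolding e_def d_def by linarith
qed

section \<open>The kernel on the disk and the correlation functions\<close>

text \<open>For a 2 by 2 matrix, permanent times determinant is a difference of two squares, and the
  off-diagonal entries are complex conjugates.\<close>

lemma perdet_S_disk_matrix:
  fixes z w :: complex and s :: real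
  shows "Re (perdet (S_disk_matrix (vector [z, w] :: complex^2) s))
    = (((1 + s * (cmod z)\<^sup>2) / ((1 + s) * (1 - (cmod z)\<^sup>2)))
        * ((1 + s * (cmod w)\<^sup>2) / ((1 + s) * (1 - (cmod w)\<^sup>2))))\<^sup>2
      - cmod (S_disk z w s)^4"
proof -
  have diag: "S_disk z z s = of_real ((1 + s * (cmod z)\<^sup>2) / ((1 + s) * (1 - (cmod z)\<^sup>2)))" for z
    unfolding S_disk_def mult.assoc complex_norm_square[symmetric] by simp
  have off: "S_disk z w s * S_disk w z s = of_real ((cmod (S_disk z w s))\<^sup>2)"
    unfolding cnj_S_disk[of z w s, symmetric] by (rule complex_norm_square[symmetric])
  have "perdet (S_disk_matrix (vector [z, w] :: complex^2) s)
      = (S_disk z z s * S_disk w w s + S_disk z w s * S_disk w z s)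
        * (S_disk z z s * S_disk w w s - S_disk z w s * S_disk w z s)"
    unfolding perdet_def per_2 det_2 by (simp add: S_disk_matrix_def vector_2)
  also have "\<dots> = of_real ((((1 + s * (cmod z)\<^sup>2) / ((1 + s) * (1 - (cmod z)\<^sup>2)))
        * ((1 + s * (cmod w)\<^sup>2) / ((1 + s) * (1 - (cmod w)\<^sup>2))))\<^sup>2
      - ((cmod (S_disk z w s))\<^sup>2)\<^sup>2)"
    unfolding off diag of_real_diff of_real_power of_real_mult by algebra
  finally show ?thesis by simp
qed

text \<open>The triangle inequality bounds the numerator below and the denominator above; both are
  sharp when \<open>z * cnj w\<close> is a nonpositive real.\<close>

lemma cmod_S_disk_ge:
  assumes "0 \<le> s" "cmod z * cmod w < 1" "s * (cmod z * cmod w) \<le> 1"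
  shows "(1 - s * (cmod z * cmod w)) / ((1 + s) * (1 + cmod z * cmod w)) \<le> cmod (S_disk z w s)"
proof -
  let ?u = "z * cnj w"
  have u: "cmod ?u = cmod z * cmod w" by (simp add: norm_mult)
  have "?u \<noteq> 1" using assms(2) u by (metis norm_one less_irrefl)
  then have pos: "0 < cmod (1 - ?u)" by simp
  have ub: "cmod (1 - ?u) \<le> 1 + cmod z * cmod w"
    using norm_triangle_ineq4[of 1 ?u] u by simp
  have "1 - s * (cmod z * cmod w) \<le> cmod (1 + of_real s * ?u)"
    using norm_triangle_ineq4[of "1 + of_real s * ?u" "of_real s * ?u"] assms(1) u
    by (simp add: norm_mult)
  then have "(1 - s * (cmod z * cmod w)) / ((1 + s) * (1 + cmod z * cmod w))
      \<le> cmod (1 + of_real s * ?u) / ((1 + s) * cmod (1 - ?u))"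
    using assms ub pos by (intro frac_le mult_left_mono mult_pos_pos) auto
  also have "cmod (1 + of_real s) = 1 + s"
    using assms(1) by (metis norm_of_real of_real_1 of_real_add abs_of_nonneg add_nonneg_nonneg zero_le_one)
  then have "cmod (1 + of_real s * ?u) / ((1 + s) * cmod (1 - ?u)) = cmod (S_disk z w s)"
    by (simp add: S_disk_def norm_divide norm_mult mult.assoc)
  finally show ?thesis .
qed

theorem proposition1p7:
  fixes r :: real
  assumes "0 \<le> r" and "r < r_crit"
  shows "\<forall>z\<in>unit_disk. \<forall>w\<in>unit_disk. g_disk z w r < 1"
proof (intro ballI)
  fix z w assume "z \<in> unit_disk" "w \<in> unit_disk"
  then have zw: "cmod z < 1" "cmod w < 1" by (auto simp: unit_disk_def)
  have r: "0 \<le> r" "r < 1" and K: "96 * r\<^sup>2 < (r\<^sup>2 + 6 * r + 1)\<^sup>2"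
    using assms r_crit_less r_crit_quartic[OF assms] by auto
  define a b c where "a = (cmod z)\<^sup>2" and "b = (cmod w)\<^sup>2" and "c = cmod z * cmod w"
  define s where "s = r * (a * b)"
  have a: "0 \<le> a" "a < 1" and b: "0 \<le> b" "b < 1"
    using zw by (auto simp: a_def b_def power_less_one_iff)
  have c: "0 \<le> c" "c < 1" "c\<^sup>2 = a * b"
    using zw mult_strict_mono[of "cmod z" 1 "cmod w" 1]
    by (auto simp: a_def b_def c_def power_mult_distrib)
  have s: "0 \<le> s" using r a b by (simp add: s_def)
  have sc: "s * c = r * c^3" using c(3) unfolding s_def by algebra
  have sc1: "s * c \<le> 1" unfolding sc using r c by (intro mult_le_one) (auto simp: power_le_one)
  define y where "y = cmod (S_disk z w s)"
  have "(1 - s * c) / ((1 + s) * (1 + c)) \<le> y"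
    using cmod_S_disk_ge[of s z w] s c(2) sc1 unfolding c_def y_def by simp
  then have "(1 - r * c^3) / (1 + c) / (1 + s) \<le> y"
    unfolding sc by (simp add: mult.commute)
  then have "(1 - r * c^3) / (1 + c) \<le> (1 + s) * y"
    using s by (simp add: pos_divide_le_eq mult.commute del: divide_divide_eq_left)
  then have "((1 - r * c^3) / (1 + c))^4 \<le> ((1 + s) * y)^4"
    using sc1 c(1) unfolding sc by (intro power_mono) auto
  from correlation_ineq[OF r K a b c(1,3) this, folded s_def]
  have main: "((1 + r * a) * (1 + r * b))\<^sup>2 *
      ((1 + s * a)\<^sup>2 * (1 + s * b)\<^sup>2 - ((1 - a) * (1 - b))\<^sup>2 * ((1 + s) * y)^4)
    < (1 + r) * ((1 + r * a\<^sup>2) * (1 + r * b\<^sup>2)) * (1 + r * (a * b)\<^sup>2) * (1 + s)^4" .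
  have pos: "0 < 1 + r" "0 < 1 + r * a\<^sup>2" "0 < 1 + r * b\<^sup>2" "0 < 1 + r * (a * b)\<^sup>2"
    "0 < 1 + s" "0 < 1 + r * a" "0 < 1 + r * b" "0 < 1 - a" "0 < 1 - b"
    using r a b s by (auto intro: add_pos_nonneg)
  have pw: "cmod z ^ 4 = a\<^sup>2" "cmod w ^ 4 = b\<^sup>2" by (auto simp: a_def b_def)
  have rho1: "rho1_disk z r = (1 + r) * (1 + r * a\<^sup>2) / ((1 + r * a)\<^sup>2 * (1 - a)\<^sup>2)"
    "rho1_disk w r = (1 + r) * (1 + r * b\<^sup>2) / ((1 + r * b)\<^sup>2 * (1 - b)\<^sup>2)"
    unfolding rho1_disk_def pw by (simp_all add: a_def b_def)
  have s_alt: "r * (cmod z)\<^sup>2 * (cmod w)\<^sup>2 = s" by (simp add: s_def a_def b_def)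
  have "rho2_disk z w r = (1 + r) / (1 + r * (a * b)\<^sup>2) *
      (((1 + s * a) / ((1 + s) * (1 - a)) * ((1 + s * b) / ((1 + s) * (1 - b))))\<^sup>2 - y^4)"
    unfolding rho2_disk_def s_alt perdet_S_disk_matrix pw
    by (simp add: a_def b_def y_def power_mult_distrib mult.assoc)
  also have "\<dots> = (1 + r) * ((1 + s * a)\<^sup>2 * (1 + s * b)\<^sup>2 - ((1 - a) * (1 - b))\<^sup>2 * ((1 + s) * y)^4)
      / ((1 + r * (a * b)\<^sup>2) * (1 + s)^4 * ((1 - a) * (1 - b))\<^sup>2)"
  proof -
    have "((1 + s * a) / ((1 + s) * (1 - a)) * ((1 + s * b) / ((1 + s) * (1 - b))))\<^sup>2
        = (1 + s * a)\<^sup>2 * (1 + s * b)\<^sup>2 / ((1 + s)^4 * ((1 - a) * (1 - b))\<^sup>2)"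
      unfolding times_divide_times_eq power_divide by (rule arg_cong2[where f = "(/)"]; algebra)
    moreover have "y^4 = ((1 - a) * (1 - b))\<^sup>2 * ((1 + s) * y)^4 / ((1 + s)^4 * ((1 - a) * (1 - b))\<^sup>2)"
      using pos by (simp add: power_mult_distrib)
    ultimately show ?thesis
      by (simp only: diff_divide_distrib[symmetric] times_divide_times_eq mult.assoc)
  qed
  finally have rho2: "rho2_disk z w r = \<dots>" .
  have "0 < rho1_disk z r * rho1_disk w r" unfolding rho1 using pos by simp
  moreover have "rho2_disk z w r < rho1_disk z r * rho1_disk w r"
  proof -
    \<comment> \<open>The product of the one-point functions carries one more factor
      \<open>1 + r\<close> than \<open>rho2_disk\<close>. The common denominator
      \<open>((1 - a) * (1 - b))^2\<close> is left out of the cross-multiplication and divided in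
      afterwards.\<close>
    have "(1 + r) * (((1 + r * a) * (1 + r * b))\<^sup>2 *
        ((1 + s * a)\<^sup>2 * (1 + s * b)\<^sup>2 - ((1 - a) * (1 - b))\<^sup>2 * ((1 + s) * y)^4))
      < (1 + r) * ((1 + r) * ((1 + r * a\<^sup>2) * (1 + r * b\<^sup>2)) * (1 + r * (a * b)\<^sup>2) * (1 + s)^4)"
      using main pos(1) by (rule mult_strict_left_mono)
    moreover define V where
      "V = (1 + s * a)\<^sup>2 * (1 + s * b)\<^sup>2 - ((1 - a) * (1 - b))\<^sup>2 * ((1 + s) * y)^4"
    moreover define k where "k = (1 + r * (a * b)\<^sup>2) * (1 + s)^4"
    moreover define l where "l = ((1 + r * a) * (1 + r * b))\<^sup>2"
    moreover have "0 < k" "0 < l" unfolding k_def l_def using pos by simp_all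
    ultimately have "(1 + r) * V / k < (1 + r)\<^sup>2 * ((1 + r * a\<^sup>2) * (1 + r * b\<^sup>2)) / l"
      by (simp add: divide_simps power2_eq_square mult_ac)
    then have "(1 + r) * V / k / ((1 - a) * (1 - b))\<^sup>2
        < (1 + r)\<^sup>2 * ((1 + r * a\<^sup>2) * (1 + r * b\<^sup>2)) / l / ((1 - a) * (1 - b))\<^sup>2"
      using pos by (intro divide_strict_right_mono) auto
    then show ?thesis
      unfolding rho1 rho2 V_def k_def l_def by (simp add: power2_eq_square mult_ac)
  qed
  ultimately show "g_disk z w r < 1" by (simp add: g_disk_def)
qed

end
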